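(* For every integer $n\ge 0$, $$F_{2n+1}(s) = \sum_{j=0}^{n}\binom{2n+1}{2j+1}\frac{B_{2n-2j}}{j+1}F_{2j+2}(s).$$
   Context: The Fibonacci polynomials $F_n(s)$ are defined by $F_0(s)=0$, $F_1(s)=1$ and $F_n(s)=F_{n-1}(s)+sF_{n-2}(s)$ for $n\ge 2$. The Bernoulli numbers $B_n$ are defined by $B_0=1$ and $B_n=\sum_{k=0}^n\binom{n}{k}B_k$ for $n>1$ (equivalently $\sum_{n\ge 0}B_n\frac{z^n}{n!}=\frac{z}{e^z-1}$). *)

theory Defs
  imports "HOL-Computational_Algebra.Polynomial"
begin

text \<open>Fibonacci polynomials in one indeterminate \<open>s\<close>, represented by \<open>[:0, 1:]\<close>.\<close>

fun fib_poly :: "nat \<Rightarrow> rat poly" where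
  "fib_poly 0 = 0"
| "fib_poly (Suc 0) = 1"
| "fib_poly (Suc (Suc n)) = fib_poly (Suc n) + [:0, 1:] * fib_poly n"

text \<open>The usual recurrence \<open>B\<^sub>m = (\<Sum>k\<le>m. (m choose k) * B\<^sub>k)\<close> for \<open>m > 1\<close> is, after
  cancelling \<open>B\<^sub>m\<close>, a linear equation for \<open>B\<^bsub>m-1\<^esub>\<close>. The function below solves it with
  \<open>m = n + 2\<close>; the two lemmas show that this is the only sequence with \<open>B\<^sub>0 = 1\<close> satisfying it.
  In this convention \<open>B\<^sub>1 = -1/2\<close>.\<close>

fun bernoulli_num :: "nat \<Rightarrow> rat" where
  "bernoulli_num 0 = 1"
| "bernoulli_num (Suc n) =
     - (\<Sum>k\<le>n. of_nat ((n + 2) choose k) * bernoulli_num k) / of_nat (n + 2)"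

lemma bernoulli_num_recurrence:
  assumes "m > 1"
  shows "bernoulli_num m = (\<Sum>k=0..m. of_nat (m choose k) * bernoulli_num k)"
proof -
  obtain n where m: "m = Suc (Suc n)"
    using assms by (metis One_nat_def less_imp_Suc_add add_Suc_right plus_1_eq_Suc)
  have nz: "(of_nat (n + 2) :: rat) \<noteq> 0"
    by (metis add_2_eq_Suc' of_nat_neq_0)
  have "of_nat (n + 2) * bernoulli_num (Suc n) =
        - (\<Sum>k\<le>n. of_nat ((n + 2) choose k) * bernoulli_num k)"
    using nz by (simp del: of_nat_add)
  moreover have "(m choose Suc n) = n + 2" "n + 2 = m"
    by (simp_all add: m)
  ultimately show ?thesis
    unfolding m atLeast0AtMost by (simp del: bernoulli_num.simps of_nat_add of_nat_Suc binomial_Suc_Suc)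
qed

lemma bernoulli_num_unique:
  fixes B :: "nat \<Rightarrow> rat"
  assumes "B 0 = 1"
    and rec: "\<And>m. m > 1 \<Longrightarrow> B m = (\<Sum>k=0..m. of_nat (m choose k) * B k)"
  shows "B = bernoulli_num"
proof
  fix n show "B n = bernoulli_num n"
  proof (induction n rule: less_induct)
    case (less n)
    show ?case
    proof (cases n)
      case 0
      then show ?thesis using assms(1) by simp
    next
      case (Suc k)
      have nz: "(of_nat (k + 2) :: rat) \<noteq> 0"
        by (metis add_2_eq_Suc' of_nat_neq_0)
      have c: "(Suc (Suc k) choose Suc k) = k + 2" by simp
      have "B (Suc (Suc k)) = (\<Sum>i\<le>Suc (Suc k). of_nat (Suc (Suc k) choose i) * B i)"
        using rec[of "Suc (Suc k)"] by (simp only: atLeast0AtMost)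
      then have "of_nat (k + 2) * B (Suc k) = - (\<Sum>i\<le>k. of_nat (Suc (Suc k) choose i) * B i)"
        using c by (simp del: of_nat_add of_nat_Suc binomial_Suc_Suc)
      also have "(\<Sum>i\<le>k. of_nat (Suc (Suc k) choose i) * B i)
               = (\<Sum>i\<le>k. of_nat ((k + 2) choose i) * bernoulli_num i)"
        using less Suc by (intro sum.cong) auto
      finally show ?thesis
        using nz Suc by (simp add: field_simps del: of_nat_add)
    qed
  qed
qed

end

(* Let x + y = 1 and s = -x y. By Binet's formula (x - y) F_k(s) = k! [z^k] D with
   D = exp(x z) - exp(y z). If B is the exponential generating function of the Bernoulli
   numbers, then C = B + z/2 is even, and B(-z) = exp(z) B(z) shows that B D is odd. So the
   coefficient of z^(2n+2) in C D agrees with that in z D / 2, which is the claim after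
   clearing factorials. Rational x already give infinitely many values of s. *)
theory Submission
  imports Defs "HOL-Computational_Algebra.Formal_Power_Series"
begin

unbundle fps_syntax

definition bernoulli_fps :: "rat fps" where
  "bernoulli_fps = Abs_fps (\<lambda>n. bernoulli_num n / fact n)"

text \<open>Compares coefficients using the Bernoulli recurrence, which fails only at index 1: there
  the binomial sum is B_0 + B_1, exceeding B_1 by 1. This is what \<open>fps_X\<close>
  records.\<close>

lemma bernoulli_fps_mult_exp: "bernoulli_fps * fps_exp 1 = bernoulli_fps + fps_X"
proof (rule fps_ext)
  fix m :: nat
  have coeff: "(bernoulli_fps * fps_exp 1) $ m =
      (\<Sum>k=0..m. of_nat (m choose k) * bernoulli_num k) / fact m"
    by (auto simp: bernoulli_fps_def fps_mult_nth binomial_fact sum_divide_distrib intro!: sum.cong)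
  consider "m = 0" | "m = 1" | "m > 1" by linarith
  then show "(bernoulli_fps * fps_exp 1) $ m = (bernoulli_fps + fps_X) $ m"
  proof cases
    case 3
    then show ?thesis
      using coeff bernoulli_num_recurrence[of m] by (simp add: bernoulli_fps_def)
  qed (simp_all add: coeff bernoulli_fps_def)
qed

lemma fps_exp_1_neq_1: "fps_exp 1 \<noteq> (1 :: rat fps)"
  by (auto dest: arg_cong[where f = "\<lambda>f. f $ 1"])

definition fps_reflect :: "rat fps \<Rightarrow> rat fps" where
  "fps_reflect f = fps_compose f (fps_const (-1) * fps_X)"

lemma fps_reflect_nth: "fps_reflect f $ n = (-1) ^ n * f $ n"
  by (simp only: fps_reflect_def fps_compose_linear fps_nth_Abs_fps)

lemma fps_reflect_mult: "fps_reflect (f * g) = fps_reflect f * fps_reflect g"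
  unfolding fps_reflect_def by (rule fps_compose_mult_distrib) simp

lemma fps_reflect_exp: "fps_reflect (fps_exp c) = fps_exp (- c)"
  by (simp only: fps_reflect_def fps_exp_compose_linear) simp

lemma fps_reflect_add: "fps_reflect (f + g) = fps_reflect f + fps_reflect g"
  by (rule fps_ext) (simp add: fps_reflect_nth algebra_simps)

lemma fps_reflect_diff: "fps_reflect (f - g) = fps_reflect f - fps_reflect g"
  by (rule fps_ext) (simp add: fps_reflect_nth algebra_simps)

lemma fps_reflect_X: "fps_reflect fps_X = - fps_X"
  by (rule fps_ext) (simp add: fps_reflect_nth)

text \<open>Writing E for exp(z), both sides times E - 1 equal zE: for the left, reflect BE = B + z
  and multiply by E; for the right, use B(E - 1) = z. The nonzero factor E - 1 then cancels.\<close>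

lemma fps_reflect_bernoulli: "fps_reflect bernoulli_fps = bernoulli_fps + fps_X"
proof -
  let ?R = "fps_reflect bernoulli_fps" and ?E = "fps_exp 1 :: rat fps"
  have inv: "fps_exp (-1) * ?E = 1"
    by (simp add: fps_exp_add_mult[symmetric])
  have "fps_reflect (bernoulli_fps * ?E) = fps_reflect (bernoulli_fps + fps_X)"
    by (simp only: bernoulli_fps_mult_exp)
  then have "?R * fps_exp (-1) = ?R - fps_X"
    by (simp add: fps_reflect_mult fps_reflect_exp fps_reflect_add fps_reflect_X)
  then have "?R * (fps_exp (-1) * ?E) = (?R - fps_X) * ?E"
    by (simp only: mult.assoc[symmetric])
  then have "?R * (?E - 1) = fps_X * ?E"
    unfolding inv by (simp add: algebra_simps)
  also have "\<dots> = (bernoulli_fps + fps_X) * (?E - 1)"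
    using bernoulli_fps_mult_exp by (simp add: algebra_simps)
  finally show ?thesis
    using fps_exp_1_neq_1 by simp
qed

lemma sum_even_indices:
  fixes g :: "nat \<Rightarrow> 'a :: comm_monoid_add"
  assumes "\<And>i. odd i \<Longrightarrow> i \<le> 2 * m \<Longrightarrow> g i = 0"
  shows "(\<Sum>i\<le>2 * m. g i) = (\<Sum>j\<le>m. g (2 * j))"
  using assms by (induction m) auto

text \<open>With Binet's formula this is the theorem evaluated at s = -xy and multiplied by x -
  y.\<close>

lemma bernoulli_power_difference:
  fixes x y :: rat
  assumes "x + y = 1"
  shows "(\<Sum>j\<le>n. of_nat ((2 * n + 1) choose (2 * j + 1)) * bernoulli_num (2 * n - 2 * j)
             / of_nat (j + 1) * (x ^ (2 * j + 2) - y ^ (2 * j + 2)))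
         = x ^ (2 * n + 1) - y ^ (2 * n + 1)" (is "?L = ?r")
proof -
  define C where "C = bernoulli_fps + fps_const (1/2) * fps_X"
  define D where "D = fps_exp x - fps_exp y"
  have D_nth: "D $ k = (x ^ k - y ^ k) / fact k" for k
    by (simp add: D_def diff_divide_distrib)
  have C_nth: "C $ k = bernoulli_num k / fact k" if "k \<noteq> 1" for k
    using that by (simp add: C_def bernoulli_fps_def)
  have C_odd: "C $ k = 0" if "odd k" for k
  proof -
    have "fps_reflect bernoulli_fps $ k = (bernoulli_fps + fps_X) $ k"
      by (simp only: fps_reflect_bernoulli)
    then have "(-1) ^ k * bernoulli_fps $ k = bernoulli_fps $ k + fps_X $ k"
      by (simp only: fps_reflect_nth fps_add_nth)
    \<comment> \<open>For odd k other than 1 the reflection formula makes the coefficient of B its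
      own negative; at k = 1 the added 1/2 cancels B_1 = -1/2.\<close>
    with that show ?thesis by (cases "k = 1") (auto simp: C_def bernoulli_fps_def)
  qed
  have y: "y = 1 - x" using assms by simp
  have "fps_reflect (bernoulli_fps * D) = bernoulli_fps * (fps_exp 1 * (fps_exp (-x) - fps_exp (-y)))"
    by (simp add: fps_reflect_mult fps_reflect_bernoulli bernoulli_fps_mult_exp[symmetric]
        D_def fps_reflect_diff fps_reflect_exp mult.assoc)
  \<comment> \<open>Since x + y = 1, the factor exp(z) turns exp(-xz) into exp(yz) and exp(-yz) into
    exp(xz).\<close>
  also have "fps_exp 1 * (fps_exp (-x) - fps_exp (-y)) = - D"
    by (simp add: D_def y right_diff_distrib fps_exp_add_mult[symmetric])
  finally have BD_odd: "fps_reflect (bernoulli_fps * D) = bernoulli_fps * - D" .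
  have "(-1) ^ (2*n+2) * (bernoulli_fps * D) $ (2*n+2) = - (bernoulli_fps * D) $ (2*n+2)"
    using arg_cong[OF BD_odd, of "\<lambda>f. f $ (2*n+2)"]
    by (simp only: fps_reflect_nth mult_minus_right fps_neg_nth)
  then have BD: "(bernoulli_fps * D) $ (2*n+2) = 0" by simp
  have "(C * D) $ (2*n+2) = (bernoulli_fps * D) $ (2*n+2) + (fps_const (1/2) * (fps_X * D)) $ (2*n+2)"
    by (simp only: C_def distrib_right fps_add_nth mult.assoc)
  also have "\<dots> = D $ (2*n+1) / 2"
    unfolding BD by (simp del: fps_const_divide)
  finally have CD: "(C * D) $ (2*n+2) = D $ (2*n+1) / 2" .
  have "(D * C) $ (2*n+2) = (\<Sum>i\<le>2*Suc n. D $ i * C $ (2*n+2-i))"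
    by (simp add: fps_mult_nth atLeast0AtMost)
  also have "\<dots> = (\<Sum>j\<le>Suc n. D $ (2*j) * C $ (2*n+2-2*j))"
  proof (rule sum_even_indices)
    fix i :: nat assume "odd i" "i \<le> 2 * Suc n"
    then show "D $ i * C $ (2*n+2-i) = 0"
      using C_odd[of "2*n+2-i"] by simp
  qed
  \<comment> \<open>The term j = 0 drops out because D has constant term 0; the rest is
    reindexed.\<close>
  also have "\<dots> = (\<Sum>j\<le>n. D $ (2*j+2) * C $ (2*n-2*j))"
    by (subst sum.atMost_Suc_shift) (simp add: D_nth[of 0])
  also have "\<dots> = (\<Sum>j\<le>n. (x ^ (2*j+2) - y ^ (2*j+2)) * bernoulli_num (2*n-2*j)
      / (fact (2*j+2) * fact (2*n-2*j)))"
  proof (rule sum.cong[OF refl])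
    fix j :: nat
    \<comment> \<open>Index 1 is the only one where the coefficients of C and B differ, and an even
      index avoids it.\<close>
    have "2*n - 2*j \<noteq> 1" by presburger
    then have "C $ (2*n-2*j) = bernoulli_num (2*n-2*j) / fact (2*n-2*j)"
      by (rule C_nth)
    then show "D $ (2*j+2) * C $ (2*n-2*j) = (x ^ (2*j+2) - y ^ (2*j+2)) * bernoulli_num (2*n-2*j)
        / (fact (2*j+2) * fact (2*n-2*j))"
      by (simp only: D_nth times_divide_times_eq)
  qed
  finally have S: "(\<Sum>j\<le>n. (x ^ (2*j+2) - y ^ (2*j+2)) * bernoulli_num (2*n-2*j)
      / (fact (2*j+2) * fact (2*n-2*j))) = D $ (2*n+1) / 2"
    using CD by (simp only: mult.commute)
  \<comment> \<open>The denominator j + 1 is absorbed by (2j+2)! = 2(j+1)(2j+1)!. The resulting 2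
    cancels the 1/2 in \<open>S\<close>.\<close>
  have binom: "of_nat ((2*n+1) choose (2*j+1)) / (of_nat (j+1) :: rat)
      = 2 * fact (2*n+1) / (fact (2*j+2) * fact (2*n-2*j))" if "j \<le> n" for j
  proof -
    have "of_nat ((2*n+1) choose (2*j+1)) = (fact (2*n+1) / (fact (2*j+1) * fact (2*n-2*j)) :: rat)"
      using that by (subst binomial_fact) auto
    moreover have "fact (2*j+2) = (2 * of_nat (j+1) * fact (2*j+1) :: rat)"
      using fact_Suc[of "2*j+1", where 'a = rat] by simp
    ultimately show ?thesis
      by (simp only:) (simp add: divide_simps del: fact_Suc of_nat_Suc of_nat_add)
  qed
  have "?L = (\<Sum>j\<le>n. 2 * fact (2*n+1) * ((x ^ (2*j+2) - y ^ (2*j+2)) * bernoulli_num (2*n-2*j)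
      / (fact (2*j+2) * fact (2*n-2*j))))"
  proof (rule sum.cong[OF refl])
    fix j assume "j \<in> {..n}"
    then have "j \<le> n" by simp
    have reorder: "a * b / c * d = a / c * (d * b)" for a b c d :: rat by simp
    show "of_nat ((2*n+1) choose (2*j+1)) * bernoulli_num (2*n-2*j) / of_nat (j+1)
          * (x ^ (2*j+2) - y ^ (2*j+2))
        = 2 * fact (2*n+1) * ((x ^ (2*j+2) - y ^ (2*j+2)) * bernoulli_num (2*n-2*j)
          / (fact (2*j+2) * fact (2*n-2*j)))"
      unfolding reorder binom[OF \<open>j \<le> n\<close>]
      by (simp only: times_divide_eq_left times_divide_eq_right ac_simps)
  qed
  also have "\<dots> = 2 * fact (2*n+1) * (D $ (2*n+1) / 2)"
    by (simp only: sum_distrib_left[symmetric] S)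
  also have "\<dots> = ?r"
    unfolding D_nth by (simp del: fact_Suc)
  finally show ?thesis .
qed

text \<open>x and y are the roots of t^2 = t + s for s = -xy, so their powers obey the Fibonacci
  recurrence. Keeping x - y as a factor avoids division and allows x = y.\<close>

lemma fib_poly_binet:
  fixes x y :: rat
  assumes "x + y = 1"
  shows "(x - y) * poly (fib_poly k) (- (x * y)) = x ^ k - y ^ k"
proof (induction k rule: fib_poly.induct)
  case (3 k)
  have y: "y = 1 - x" using assms by simp
  have "(x - y) * poly (fib_poly (Suc (Suc k))) (- (x * y)) =
      (x - y) * poly (fib_poly (Suc k)) (- (x * y)) - x * y * ((x - y) * poly (fib_poly k) (- (x * y)))"
    by (simp add: algebra_simps)
  also have "\<dots> = (x ^ Suc k - y ^ Suc k) - x * y * (x ^ k - y ^ k)"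
    by (simp only: 3)
  also have "\<dots> = x ^ Suc (Suc k) - y ^ Suc (Suc k)"
    by (simp add: y algebra_simps)
  finally show ?case .
qed auto

theorem mainTheorem4:
  fixes n :: nat
  shows "fib_poly (2 * n + 1) =
    (\<Sum>j=0..n. smult (of_nat ((2 * n + 1) choose (2 * j + 1)) * bernoulli_num (2 * n - 2 * j) / of_nat (j + 1))
      (fib_poly (2 * j + 2)))"
    (is "?p = ?q")
proof -
  \<comment> \<open>These are the values -xy for x = m + 1 and y = -m, a rational pair with sum 1.
    Here x - y = 2m + 1 is positive, so it can be cancelled below.\<close>
  define s :: "nat \<Rightarrow> rat" where "s = (\<lambda>m. of_nat m * (of_nat m + 1))"
  have "strict_mono s"
    by (rule strict_monoI) (auto simp: s_def intro!: mult_strict_mono)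
  then have inf: "infinite (range s)"
    using strict_mono_imp_inj_on finite_imageD by blast
  have "poly (?p - ?q) (s m) = 0" for m
  proof -
    define x y :: rat where "x = of_nat m + 1" and "y = - of_nat m"
    have xy: "x + y = 1" and s: "s m = - (x * y)"
      by (auto simp: x_def y_def s_def algebra_simps)
    have "x - y > 0"
      by (simp add: x_def y_def add_pos_nonneg)
    have "(x - y) * poly ?q (s m) = (\<Sum>j\<le>n. of_nat ((2*n+1) choose (2*j+1)) * bernoulli_num (2*n-2*j)
        / of_nat (j+1) * ((x - y) * poly (fib_poly (2*j+2)) (s m)))"
      by (simp only: poly_sum poly_smult sum_distrib_left atLeast0AtMost mult.left_commute)
    also have "\<dots> = (x - y) * poly ?p (s m)"
      unfolding s fib_poly_binet[OF xy] by (rule bernoulli_power_difference[OF xy])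
    finally show ?thesis using \<open>x - y > 0\<close> by simp
  qed
  \<comment> \<open>The difference of the two sides has infinitely many roots, so it is the zero
    polynomial.\<close>
  then have "range s \<subseteq> {a. poly (?p - ?q) a = 0}" by blast
  with inf have "?p - ?q = 0"
    using poly_roots_finite finite_subset by blast
  then show ?thesis by simp
qed

end
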